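(* Let $X$ and $Y$ be metric spaces, and let $n\in\mathbb{N}$. An $n$-valued function $\phi\colon X\multimap Y$ is continuous if and only if the corresponding function $\Phi\colon X\to D_n(Y)$ is continuous.
   Context: An $n$-valued function $\phi\colon X\multimap Y$ assigns to each $x\in X$ a subset $\phi(x)\subset Y$ of cardinality exactly $n$. It is upper semi-continuous if $\phi(x)$ is closed for all $x$ and $\{x\in X\mid\phi(x)\subset V\}$ is open in $X$ for every open $V\subset Y$; lower semi-continuous if $\{x\in X\mid\phi(x)\cap V\neq\varnothing\}$ is open in $X$ for every open $V\subset Y$; continuous if it is both. $F_n(Y)=\{(y_1,\ldots,y_n)\in Y^n\mid y_i\neq y_j\text{ if }i\neq j\}$ has the topology induced from $Y^n$, and $D_n(Y)=F_n(Y)/S_n$ (quotient by permutation of coordinates) has the quotient topology. Identifying $n$-point subsets of $Y$ with points of $D_n(Y)$, the function $\Phi\colon X\to D_n(Y)$ corresponding to $\phi$ is $x\mapsto\phi(x)$. *)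

theory Defs
  imports "HOL-Analysis.Analysis" "HOL-Combinatorics.Permutations"
begin

definition n_valued :: "nat \<Rightarrow> 'a set \<Rightarrow> 'b set \<Rightarrow> ('a \<Rightarrow> 'b set) \<Rightarrow> bool" where
  "n_valued n X Y \<phi> \<longleftrightarrow> (\<forall>x\<in>X. \<phi> x \<subseteq> Y \<and> finite (\<phi> x) \<and> card (\<phi> x) = n)"

definition usc :: "'a topology \<Rightarrow> 'b topology \<Rightarrow> ('a \<Rightarrow> 'b set) \<Rightarrow> bool" where
  "usc S T \<phi> \<longleftrightarrow>
     (\<forall>x\<in>topspace S. closedin T (\<phi> x)) \<and>
     (\<forall>V. openin T V \<longrightarrow> openin S {x \<in> topspace S. \<phi> x \<subseteq> V})"

definition lsc :: "'a topology \<Rightarrow> 'b topology \<Rightarrow> ('a \<Rightarrow> 'b set) \<Rightarrow> bool" where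
  "lsc S T \<phi> \<longleftrightarrow>
     (\<forall>V. openin T V \<longrightarrow> openin S {x \<in> topspace S. \<phi> x \<inter> V \<noteq> {}})"

definition multi_continuous :: "'a topology \<Rightarrow> 'b topology \<Rightarrow> ('a \<Rightarrow> 'b set) \<Rightarrow> bool" where
  "multi_continuous S T \<phi> \<longleftrightarrow> usc S T \<phi> \<and> lsc S T \<phi>"

definition quotient_topology :: "'a topology \<Rightarrow> ('a \<Rightarrow> 'b) \<Rightarrow> 'b topology" where
  "quotient_topology T q =
     topology (\<lambda>U. U \<subseteq> q ` topspace T \<and> openin T {x \<in> topspace T. q x \<in> U})"

lemma openin_quotient_topology:
  "openin (quotient_topology T q) U \<longleftrightarrow>
     U \<subseteq> q ` topspace T \<and> openin T {x \<in> topspace T. q x \<in> U}"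
proof -
  have "istopology (\<lambda>U. U \<subseteq> q ` topspace T \<and> openin T {x \<in> topspace T. q x \<in> U})"
    unfolding istopology_def
  proof (rule conjI; clarify)
    fix A B
    assume "A \<subseteq> q ` topspace T" and A: "openin T {x \<in> topspace T. q x \<in> A}"
      and B: "openin T {x \<in> topspace T. q x \<in> B}"
    have "{x \<in> topspace T. q x \<in> A \<inter> B} = {x \<in> topspace T. q x \<in> A} \<inter> {x \<in> topspace T. q x \<in> B}"
      by blast
    then show "A \<inter> B \<subseteq> q ` topspace T \<and> openin T {x \<in> topspace T. q x \<in> A \<inter> B}"
      using \<open>A \<subseteq> q ` topspace T\<close> A B by auto
  next
    fix K
    assume K: "\<forall>U\<in>K. U \<subseteq> q ` topspace T \<and> openin T {x \<in> topspace T. q x \<in> U}"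
    have "{x \<in> topspace T. q x \<in> \<Union>K} = (\<Union>U\<in>K. {x \<in> topspace T. q x \<in> U})"
      by blast
    moreover have "openin T (\<Union>U\<in>K. {x \<in> topspace T. q x \<in> U})"
      using K by (intro openin_Union) auto
    ultimately show "\<Union>K \<subseteq> q ` topspace T \<and> openin T {x \<in> topspace T. q x \<in> \<Union>K}"
      using K by auto
  qed
  then show ?thesis
    by (simp add: quotient_topology_def topology_inverse')
qed

lemma topspace_quotient_topology [simp]:
  "topspace (quotient_topology T q) = q ` topspace T"
proof (rule antisym)
  show "topspace (quotient_topology T q) \<subseteq> q ` topspace T"
    using openin_topspace[of "quotient_topology T q"] unfolding openin_quotient_topology by blast
  have "{x \<in> topspace T. q x \<in> q ` topspace T} = topspace T"
    by blast
  then have "openin (quotient_topology T q) (q ` topspace T)"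
    by (simp add: openin_quotient_topology)
  then show "q ` topspace T \<subseteq> topspace (quotient_topology T q)"
    by (rule openin_subset)
qed

lemma quotient_map_quotient_topology: "quotient_map T (quotient_topology T q) q"
  by (auto simp: quotient_map_def openin_quotient_topology)

text \<open>Points of \<open>Y\<^sup>n\<close> are extensional functions on \<open>{..<n}\<close>, as in \<^const>\<open>product_topology\<close>.\<close>

definition conf_space :: "nat \<Rightarrow> 'b topology \<Rightarrow> (nat \<Rightarrow> 'b) topology" where
  "conf_space n T = subtopology (product_topology (\<lambda>_. T) {..<n}) {y. inj_on y {..<n}}"

text \<open>
  A permutation of \<open>{..<n}\<close> fixes every index outside \<open>{..<n}\<close>, so \<open>y \<circ> \<sigma>\<close> is again extensional.
\<close>

definition perm_orbit :: "nat \<Rightarrow> (nat \<Rightarrow> 'b) \<Rightarrow> (nat \<Rightarrow> 'b) set" where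
  "perm_orbit n y = {y \<circ> \<sigma> | \<sigma>. \<sigma> permutes {..<n}}"

definition unordered_conf_space :: "nat \<Rightarrow> 'b topology \<Rightarrow> (nat \<Rightarrow> 'b) set topology" where
  "unordered_conf_space n T = quotient_topology (conf_space n T) (perm_orbit n)"

text \<open>
  The identification of \<open>n\<close>-point subsets with \<open>S\<^sub>n\<close>-orbits sends a subset to the set of
  its enumerations; the lemmas below show that this is the orbit of any one of them, and that
  the identification is bijective.
\<close>

definition conf_of_set :: "nat \<Rightarrow> 'b topology \<Rightarrow> 'b set \<Rightarrow> (nat \<Rightarrow> 'b) set" where
  "conf_of_set n T A = {y \<in> topspace (conf_space n T). y ` {..<n} = A}"

lemma topspace_conf_space:
  "topspace (conf_space n T) = {y \<in> {..<n} \<rightarrow>\<^sub>E topspace T. inj_on y {..<n}}"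
  by (auto simp: conf_space_def)

lemma conf_of_set_image_eq_perm_orbit:
  assumes y: "y \<in> topspace (conf_space n T)"
  shows "conf_of_set n T (y ` {..<n}) = perm_orbit n y"
proof (intro subset_antisym subsetI)
  fix z assume "z \<in> conf_of_set n T (y ` {..<n})"
  then have z: "z \<in> {..<n} \<rightarrow>\<^sub>E topspace T" "inj_on z {..<n}" "z ` {..<n} = y ` {..<n}"
    by (auto simp: conf_of_set_def topspace_conf_space)
  have y': "y \<in> {..<n} \<rightarrow>\<^sub>E topspace T" "inj_on y {..<n}"
    using y by (auto simp: topspace_conf_space)
  define \<sigma> where "\<sigma> i = (if i < n then inv_into {..<n} y (z i) else i)" for i
  have "bij_betw (inv_into {..<n} y \<circ> z) {..<n} {..<n}"
  proof (rule bij_betw_trans)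
    show "bij_betw z {..<n} (y ` {..<n})"
      using z by (simp add: bij_betw_def)
    show "bij_betw (inv_into {..<n} y) (y ` {..<n}) {..<n}"
      using y' by (simp add: bij_betw_inv_into inj_on_imp_bij_betw)
  qed
  then have "bij_betw \<sigma> {..<n} {..<n}"
    by (subst bij_betw_cong[where g = "inv_into {..<n} y \<circ> z"]) (auto simp: \<sigma>_def)
  then have "\<sigma> permutes {..<n}"
    by (rule bij_imp_permutes) (simp add: \<sigma>_def)
  moreover have "z = y \<circ> \<sigma>"
  proof
    fix i show "z i = (y \<circ> \<sigma>) i"
    proof (cases "i < n")
      case True
      then have "z i \<in> y ` {..<n}" using z(3) by blast
      then show ?thesis using True by (simp add: \<sigma>_def f_inv_into_f)
    next
      case False
      then show ?thesis using z(1) y'(1) by (auto simp: \<sigma>_def PiE_def extensional_def)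
    qed
  qed
  ultimately show "z \<in> perm_orbit n y"
    by (auto simp: perm_orbit_def)
next
  fix z assume "z \<in> perm_orbit n y"
  then obtain \<sigma> where \<sigma>: "\<sigma> permutes {..<n}" and z: "z = y \<circ> \<sigma>"
    by (auto simp: perm_orbit_def)
  have y': "y \<in> {..<n} \<rightarrow>\<^sub>E topspace T" "inj_on y {..<n}"
    using y by (auto simp: topspace_conf_space)
  have im: "\<sigma> ` {..<n} = {..<n}" using \<sigma> by (rule permutes_image)
  have "inj_on z {..<n}"
    unfolding z using y'(2) im permutes_inj_on[OF \<sigma>] by (simp add: comp_inj_on)
  moreover have zim: "z ` {..<n} = y ` {..<n}"
    unfolding z image_comp[symmetric] im ..
  moreover have "z \<in> {..<n} \<rightarrow>\<^sub>E topspace T"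
  proof (rule PiE_I)
    fix i assume "i \<in> {..<n}"
    then obtain j where "j \<in> {..<n}" "z i = y j" using zim by blast
    then show "z i \<in> topspace T" using PiE_mem[OF y'(1)] by simp
  next
    fix i assume "i \<notin> {..<n}"
    then show "z i = undefined"
      using permutes_not_in[OF \<sigma> \<open>i \<notin> {..<n}\<close>] PiE_arb[OF y'(1) \<open>i \<notin> {..<n}\<close>] by (simp add: z)
  qed
  ultimately show "z \<in> conf_of_set n T (y ` {..<n})"
    by (simp add: conf_of_set_def topspace_conf_space)
qed

lemma bij_betw_conf_of_set:
  "bij_betw (conf_of_set n T) {A. A \<subseteq> topspace T \<and> finite A \<and> card A = n}
     (topspace (unordered_conf_space n T))"
proof -
  have ex: "\<exists>y \<in> topspace (conf_space n T). y ` {..<n} = A"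
    if A: "A \<subseteq> topspace T" "finite A" "card A = n" for A
  proof -
    obtain h where h: "bij_betw h {..<n} A"
      using ex_bij_betw_nat_finite[OF A(2)] A(3) by (auto simp: atLeast0LessThan)
    have "inj_on (restrict h {..<n}) {..<n}" "restrict h {..<n} ` {..<n} = A"
      using h by (auto simp: bij_betw_def inj_on_def)
    moreover from this have "restrict h {..<n} \<in> {..<n} \<rightarrow>\<^sub>E topspace T"
      using A(1) by auto
    ultimately show ?thesis
      unfolding topspace_conf_space by blast
  qed
  show ?thesis
    unfolding bij_betw_def
  proof
    show "inj_on (conf_of_set n T) {A. A \<subseteq> topspace T \<and> finite A \<and> card A = n}"
    proof (rule inj_onI)
      fix A B
      assume "A \<in> {A. A \<subseteq> topspace T \<and> finite A \<and> card A = n}"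
        and eq: "conf_of_set n T A = conf_of_set n T B"
      then obtain y where "y \<in> topspace (conf_space n T)" "y ` {..<n} = A"
        using ex by blast
      then have "y \<in> conf_of_set n T A"
        by (simp add: conf_of_set_def)
      then have "y \<in> conf_of_set n T B"
        by (simp only: eq)
      then show "A = B"
        using \<open>y ` {..<n} = A\<close> by (simp add: conf_of_set_def)
    qed
    show "conf_of_set n T ` {A. A \<subseteq> topspace T \<and> finite A \<and> card A = n} =
        topspace (unordered_conf_space n T)" (is "?L = ?R")
    proof (intro subset_antisym subsetI)
      fix D assume "D \<in> ?L"
      then obtain A where A: "A \<subseteq> topspace T" "finite A" "card A = n" "D = conf_of_set n T A"
        by blast
      obtain y where y: "y \<in> topspace (conf_space n T)" "y ` {..<n} = A"
        using ex[OF A(1-3)] by blast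
      then have "D = perm_orbit n y"
        using A(4) conf_of_set_image_eq_perm_orbit[OF y(1)] by simp
      then show "D \<in> ?R"
        using y(1) by (simp add: unordered_conf_space_def)
    next
      fix D assume "D \<in> ?R"
      then obtain y where y: "y \<in> topspace (conf_space n T)" "D = perm_orbit n y"
        by (auto simp: unordered_conf_space_def)
      have "y ` {..<n} \<subseteq> topspace T" "finite (y ` {..<n})" "card (y ` {..<n}) = n"
        using y(1) by (auto simp: topspace_conf_space card_image)
      then show "D \<in> ?L"
        using conf_of_set_image_eq_perm_orbit[OF y(1)] y(2) by (intro image_eqI[of _ _ "y ` {..<n}"]) auto
    qed
  qed
qed

end

theory Submission
  imports Defs
begin

text \<open>
  An open set of the unordered configuration space amounts to a property of \<open>n\<close>-point sets that is
  an open condition on the ordered enumerations of the set.  So \<open>\<Phi>\<close> is continuous iff every such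
  property, read off at \<open>\<phi> x\<close>, is an open condition on \<open>x\<close>
  (\<open>continuous_map_unordered_conf_space_iff\<close>).

  If \<open>\<Phi>\<close> is continuous, it is enough to observe that ``contained in \<open>V\<close>'' and ``meets \<open>V\<close>'' are
  open conditions on enumerations: the first describes the box \<open>V\<^sup>n\<close>, the second a finite union
  of preimages of \<open>V\<close> under coordinate projections.  The values of \<open>\<phi>\<close> are finite sets in a
  Hausdorff space, hence closed.

  Conversely, let \<open>y\<close> enumerate \<open>\<phi> x\<^sub>0\<close> and let \<open>W\<close> be an open set of enumerations containing \<open>y\<close>.
  Some box of open sets \<open>B i\<close> around the points \<open>y i\<close> lies in \<open>W\<close>, and as the space is Hausdorff
  the \<open>B i\<close> can be taken disjoint.  By lower semi-continuity \<open>\<phi> x\<close> meets every \<open>B i\<close> for \<open>x\<close> near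
  \<open>x\<^sub>0\<close>.  Since \<open>\<phi> x\<close> has exactly \<open>n\<close> points and there are \<open>n\<close> disjoint sets, picking one point
  in each \<open>B i\<close> enumerates \<open>\<phi> x\<close>, and this enumeration lies in \<open>W\<close>.
\<close>

lemma enumeration_in_conf_space:
  assumes "A \<subseteq> topspace T" "finite A" "card A = n"
  obtains y where "y \<in> topspace (conf_space n T)" "y ` {..<n} = A"
proof -
  have "conf_of_set n T A \<in> perm_orbit n ` topspace (conf_space n T)"
    using bij_betw_apply[OF bij_betw_conf_of_set[of n T], of A] assms
    by (simp add: unordered_conf_space_def)
  then obtain y where y: "y \<in> topspace (conf_space n T)" "conf_of_set n T A = perm_orbit n y"
    by blast
  have "y \<in> conf_of_set n T (y ` {..<n})"
    using y(1) by (simp add: conf_of_set_def)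
  then have "y \<in> conf_of_set n T A"
    by (simp only: conf_of_set_image_eq_perm_orbit[OF y(1)] y(2))
  with y(1) that show thesis
    by (simp add: conf_of_set_def)
qed

text \<open>
  Both directions rest on the fact that the orbit of an enumeration and the set it enumerates
  determine each other, so that saturated open sets of ordered configurations are the sets
  \<open>{y. P (y ` {..<n})}\<close> that happen to be open.
\<close>

lemma continuous_map_unordered_conf_space_iff:
  assumes val: "n_valued n (topspace S) (topspace T) \<phi>"
  shows "continuous_map S (unordered_conf_space n T) (\<lambda>x. conf_of_set n T (\<phi> x)) \<longleftrightarrow>
    (\<forall>P. openin (conf_space n T) {y \<in> topspace (conf_space n T). P (y ` {..<n})} \<longrightarrow>
         openin S {x \<in> topspace S. P (\<phi> x)})"
    (is "?cont \<longleftrightarrow> ?open")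
proof
  assume cont: ?cont
  show ?open
  proof (intro allI impI)
    fix P assume P: "openin (conf_space n T) {y \<in> topspace (conf_space n T). P (y ` {..<n})}"
    define U where "U = perm_orbit n ` {y \<in> topspace (conf_space n T). P (y ` {..<n})}"
    have orbit_in_U: "perm_orbit n y \<in> U \<longleftrightarrow> P (y ` {..<n})"
      if y: "y \<in> topspace (conf_space n T)" for y
    proof
      assume "perm_orbit n y \<in> U"
      then obtain z where z: "z \<in> topspace (conf_space n T)" "P (z ` {..<n})"
          "perm_orbit n y = perm_orbit n z"
        by (auto simp: U_def)
      then have "y \<in> conf_of_set n T (z ` {..<n})"
        using conf_of_set_image_eq_perm_orbit[OF y] conf_of_set_image_eq_perm_orbit[OF z(1)] y
        by (auto simp: conf_of_set_def)
      with z(2) show "P (y ` {..<n})"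
        by (simp add: conf_of_set_def)
    qed (use y in \<open>auto simp: U_def\<close>)
    then have "{y \<in> topspace (conf_space n T). perm_orbit n y \<in> U} =
        {y \<in> topspace (conf_space n T). P (y ` {..<n})}"
      by blast
    with P have "openin (unordered_conf_space n T) U"
      by (auto simp: unordered_conf_space_def openin_quotient_topology U_def)
    then have "openin S {x \<in> topspace S. conf_of_set n T (\<phi> x) \<in> U}"
      using cont by (simp add: continuous_map_def)
    moreover have "conf_of_set n T (\<phi> x) \<in> U \<longleftrightarrow> P (\<phi> x)" if x: "x \<in> topspace S" for x
    proof -
      obtain y where "y \<in> topspace (conf_space n T)" "y ` {..<n} = \<phi> x"
        using enumeration_in_conf_space[of "\<phi> x" T n] val x by (auto simp: n_valued_def)
      then show ?thesis
        using orbit_in_U conf_of_set_image_eq_perm_orbit by metis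
    qed
    ultimately show "openin S {x \<in> topspace S. P (\<phi> x)}"
      by (simp cong: conj_cong)
  qed
next
  assume op: ?open
  show ?cont
    unfolding continuous_map_def
  proof (intro conjI allI impI)
    show "(\<lambda>x. conf_of_set n T (\<phi> x)) \<in> topspace S \<rightarrow> topspace (unordered_conf_space n T)"
      by (rule funcsetI, rule bij_betw_apply[OF bij_betw_conf_of_set])
        (use val in \<open>simp add: n_valued_def\<close>)
  next
    fix U assume "openin (unordered_conf_space n T) U"
    then have "openin (conf_space n T) {y \<in> topspace (conf_space n T). perm_orbit n y \<in> U}"
      by (simp add: unordered_conf_space_def openin_quotient_topology)
    then have "openin (conf_space n T)
        {y \<in> topspace (conf_space n T). conf_of_set n T (y ` {..<n}) \<in> U}"
      by (simp add: conf_of_set_image_eq_perm_orbit cong: conj_cong)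
    then show "openin S {x \<in> topspace S. conf_of_set n T (\<phi> x) \<in> U}"
      using op[THEN spec, of "\<lambda>A. conf_of_set n T A \<in> U"] by blast
  qed
qed

lemma openin_conf_space_image_subset:
  assumes "openin T V"
  shows "openin (conf_space n T) {y \<in> topspace (conf_space n T). y ` {..<n} \<subseteq> V}"
proof -
  have "{y \<in> topspace (conf_space n T). y ` {..<n} \<subseteq> V} = ({..<n} \<rightarrow>\<^sub>E V) \<inter> {y. inj_on y {..<n}}"
    using subsetD[OF openin_subset[OF assms]]
    by (auto simp: topspace_conf_space PiE_iff image_subset_iff extensional_def)
  moreover have "openin (product_topology (\<lambda>_. T) {..<n}) ({..<n} \<rightarrow>\<^sub>E V)"
    using assms by (simp add: openin_PiE)
  ultimately show ?thesis
    by (auto simp: conf_space_def openin_subtopology)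
qed

lemma openin_conf_space_image_meets:
  assumes "openin T V"
  shows "openin (conf_space n T) {y \<in> topspace (conf_space n T). y ` {..<n} \<inter> V \<noteq> {}}"
proof -
  have "{y \<in> topspace (conf_space n T). y ` {..<n} \<inter> V \<noteq> {}} =
      (\<Union>i\<in>{..<n}. {y \<in> topspace (conf_space n T). y i \<in> V})"
    by blast
  moreover have "openin (conf_space n T) {y \<in> topspace (conf_space n T). y i \<in> V}"
    if "i \<in> {..<n}" for i
  proof -
    have "continuous_map (conf_space n T) T (\<lambda>y. y i)"
      unfolding conf_space_def
      by (intro continuous_map_from_subtopology continuous_map_product_projection that)
    then show ?thesis
      using assms by (simp add: continuous_map_def)
  qed
  ultimately show ?thesis
    by auto
qed

text \<open>Finitely many distinct points of a Hausdorff space can be separated simultaneously: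
  around each point, intersect the finitely many neighbourhoods that separate it from the others.\<close>

lemma Hausdorff_space_separate_finite_family:
  assumes T: "Hausdorff_space T" and "finite I"
    and y: "inj_on y I" "\<And>i. i \<in> I \<Longrightarrow> y i \<in> topspace T"
  obtains G where "\<And>i. i \<in> I \<Longrightarrow> openin T (G i)" "\<And>i. i \<in> I \<Longrightarrow> y i \<in> G i"
    "disjoint_family_on G I"
proof -
  have "\<forall>i j. \<exists>U V. i \<in> I \<and> j \<in> I \<and> i \<noteq> j \<longrightarrow>
      openin T U \<and> openin T V \<and> y i \<in> U \<and> y j \<in> V \<and> disjnt U V"
    using T y unfolding Hausdorff_space_def by (meson inj_onD)
  then obtain U V where UV: "\<And>i j. i \<in> I \<and> j \<in> I \<and> i \<noteq> j \<Longrightarrow>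
      openin T (U i j) \<and> openin T (V i j) \<and> y i \<in> U i j \<and> y j \<in> V i j \<and> disjnt (U i j) (V i j)"
    by metis
  \<comment> \<open>Intersecting with the whole space covers the case that \<open>i\<close> is the only index.\<close>
  define G where "G i = (\<Inter>j\<in>I - {i}. U i j \<inter> V j i) \<inter> topspace T" for i
  show thesis
  proof
    fix i assume i: "i \<in> I"
    show "openin T (G i)"
      unfolding G_def
      by (rule openin_INT) (use UV i \<open>finite I\<close> in auto)
    show "y i \<in> G i"
      using UV y(2) i by (auto simp: G_def)
  next
    show "disjoint_family_on G I"
      unfolding disjoint_family_on_def
    proof (intro ballI impI)
      fix i j assume ij: "i \<in> I" "j \<in> I" "i \<noteq> j"
      then have "G i \<subseteq> U i j" "G j \<subseteq> V i j"
        by (auto simp: G_def)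
      with UV[of i j] ij show "G i \<inter> G j = {}"
        by (auto simp: disjnt_def)
    qed
  qed
qed

text \<open>A pigeonhole argument: one point chosen from each of \<open>n\<close> disjoint sets yields \<open>n\<close> different
  points, which must exhaust an \<open>n\<close>-point set.\<close>

lemma enumeration_along_disjoint_family:
  assumes A: "finite A" "card A = n" and disj: "disjoint_family_on B {..<n}"
    and meets: "\<And>i. i < n \<Longrightarrow> A \<inter> B i \<noteq> {}"
  obtains z where "z \<in> {..<n} \<rightarrow>\<^sub>E A" "\<And>i. i < n \<Longrightarrow> z i \<in> B i" "inj_on z {..<n}" "z ` {..<n} = A"
proof -
  define z where "z = (\<lambda>i\<in>{..<n}. SOME a. a \<in> A \<inter> B i)"
  have z: "z i \<in> A \<inter> B i" if "i < n" for i
    using meets[OF that] that by (simp add: z_def some_in_eq del: Int_iff)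
  have inj: "inj_on z {..<n}"
  proof (rule inj_onI)
    fix i j assume "i \<in> {..<n}" "j \<in> {..<n}" "z i = z j"
    with z[of i] z[of j] disj show "i = j"
      by (auto simp: disjoint_family_on_def)
  qed
  have "z ` {..<n} = A"
    using z A card_image[OF inj] by (intro card_subset_eq) auto
  moreover have "z \<in> {..<n} \<rightarrow>\<^sub>E A"
    using z by (auto simp: z_def)
  ultimately show thesis
    using that z inj by blast
qed

text \<open>
  The local argument at \<open>x\<^sub>0\<close>: enumerations close to one of \<open>\<phi> x\<^sub>0\<close> are obtained by choosing from
  small disjoint neighbourhoods of its points, each of which \<open>\<phi> x\<close> meets for \<open>x\<close> near \<open>x\<^sub>0\<close>.
\<close>

lemma lsc_imp_openin_of_openin_conf_space:
  assumes T: "Hausdorff_space T" and val: "n_valued n (topspace S) (topspace T) \<phi>"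
    and lsc: "lsc S T \<phi>"
    and P: "openin (conf_space n T) {y \<in> topspace (conf_space n T). P (y ` {..<n})}"
  shows "openin S {x \<in> topspace S. P (\<phi> x)}"
proof (subst openin_subopen, intro ballI)
  fix x0 assume "x0 \<in> {x \<in> topspace S. P (\<phi> x)}"
  then have x0: "x0 \<in> topspace S" "P (\<phi> x0)"
    by auto
  obtain y where y: "y \<in> topspace (conf_space n T)" "y ` {..<n} = \<phi> x0"
    using enumeration_in_conf_space[of "\<phi> x0" T n] val x0 by (auto simp: n_valued_def)
  obtain Q where Q: "openin (product_topology (\<lambda>_. T) {..<n}) Q"
      "{y \<in> topspace (conf_space n T). P (y ` {..<n})} = Q \<inter> {y. inj_on y {..<n}}"
    using P by (auto simp: conf_space_def openin_subtopology)
  have "y \<in> {y \<in> topspace (conf_space n T). P (y ` {..<n})}"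
    using y x0(2) by simp
  then have "y \<in> Q"
    using Q(2) by blast
  then obtain V where V: "\<And>i. i < n \<Longrightarrow> openin T (V i)" "y \<in> Pi\<^sub>E {..<n} V" "Pi\<^sub>E {..<n} V \<subseteq> Q"
    using bspec[OF Q(1)[unfolded openin_product_topology_alt], of y] that by auto
  obtain G where G: "\<And>i. i \<in> {..<n} \<Longrightarrow> openin T (G i)" "\<And>i. i \<in> {..<n} \<Longrightarrow> y i \<in> G i"
      "disjoint_family_on G {..<n}"
  proof (rule Hausdorff_space_separate_finite_family[OF T finite_lessThan, of y n])
    show "inj_on y {..<n}" "\<And>i. i \<in> {..<n} \<Longrightarrow> y i \<in> topspace T"
      using y(1) by (auto simp: topspace_conf_space)
  qed (rule that)
  define B where "B i = V i \<inter> G i" for i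
  have disj: "disjoint_family_on B {..<n}"
    using G(3) by (rule disjoint_family_on_bisimulation) (auto simp: B_def)
  \<comment> \<open>Intersecting with the whole space covers the case \<open>n = 0\<close>.\<close>
  define N where "N = (\<Inter>i\<in>{..<n}. {x \<in> topspace S. \<phi> x \<inter> B i \<noteq> {}}) \<inter> topspace S"
  show "\<exists>N. openin S N \<and> x0 \<in> N \<and> N \<subseteq> {x \<in> topspace S. P (\<phi> x)}"
  proof (intro exI conjI subsetI)
    have "openin T (B i)" if "i < n" for i
      using V(1) G(1) that by (simp add: B_def openin_Int)
    then show "openin S N"
      using lsc unfolding N_def lsc_def by (intro openin_INT) auto
    have "y i \<in> \<phi> x0 \<inter> B i" if "i < n" for i
      using V(2) G(2) y(2) that by (auto simp: B_def)
    then show "x0 \<in> N"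
      using x0(1) by (auto simp: N_def)
  next
    fix x assume "x \<in> N"
    then have x: "x \<in> topspace S" "\<And>i. i < n \<Longrightarrow> \<phi> x \<inter> B i \<noteq> {}"
      by (auto simp: N_def)
    then have \<phi>x: "\<phi> x \<subseteq> topspace T" "finite (\<phi> x)" "card (\<phi> x) = n"
      using val by (auto simp: n_valued_def)
    obtain z where z: "z \<in> {..<n} \<rightarrow>\<^sub>E \<phi> x" "\<And>i. i < n \<Longrightarrow> z i \<in> B i" "inj_on z {..<n}"
        "z ` {..<n} = \<phi> x"
      using enumeration_along_disjoint_family[OF \<phi>x(2,3) disj x(2)] by blast
    have "z \<in> Pi\<^sub>E {..<n} V"
      using z(1,2) by (auto simp: PiE_iff B_def)
    then have "z \<in> Q \<inter> {y. inj_on y {..<n}}"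
      using V(3) z(3) by blast
    then have "P (z ` {..<n})"
      using Q(2) by blast
    then show "x \<in> {x \<in> topspace S. P (\<phi> x)}"
      using x(1) z(4) by simp
  qed
qed

theorem theorem8:
  fixes X :: "'a metric" and Y :: "'b metric" and n :: nat and \<phi> :: "'a \<Rightarrow> 'b set"
  assumes "n_valued n (mspace X) (mspace Y) \<phi>"
  shows "multi_continuous (mtopology_of X) (mtopology_of Y) \<phi> \<longleftrightarrow>
    continuous_map (mtopology_of X) (unordered_conf_space n (mtopology_of Y))
      (\<lambda>x. conf_of_set n (mtopology_of Y) (\<phi> x))"
proof -
  let ?S = "mtopology_of X" and ?T = "mtopology_of Y"
  have Hausdorff: "Hausdorff_space ?T"
    by (simp add: mtopology_of_def Metric_space.Hausdorff_space_mtopology)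
  have val: "n_valued n (topspace ?S) (topspace ?T) \<phi>"
    using assms by simp
  have "(\<forall>P. openin (conf_space n ?T) {y \<in> topspace (conf_space n ?T). P (y ` {..<n})} \<longrightarrow>
         openin ?S {x \<in> topspace ?S. P (\<phi> x)}) \<longleftrightarrow> multi_continuous ?S ?T \<phi>" (is "?open \<longleftrightarrow> _")
  proof
    assume op: ?open
    have "closedin ?T (\<phi> x)" if "x \<in> topspace ?S" for x
      using val that closedin_Hausdorff_finite[OF Hausdorff] by (auto simp: n_valued_def)
    moreover have "openin ?S {x \<in> topspace ?S. \<phi> x \<subseteq> V}" if "openin ?T V" for V
      using op[THEN spec, of "\<lambda>A. A \<subseteq> V"] openin_conf_space_image_subset[OF that] by blast
    moreover have "openin ?S {x \<in> topspace ?S. \<phi> x \<inter> V \<noteq> {}}" if "openin ?T V" for V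
      using op[THEN spec, of "\<lambda>A. A \<inter> V \<noteq> {}"] openin_conf_space_image_meets[OF that] by blast
    ultimately show "multi_continuous ?S ?T \<phi>"
      by (simp add: multi_continuous_def usc_def lsc_def)
  next
    assume "multi_continuous ?S ?T \<phi>"
    then show ?open
      using lsc_imp_openin_of_openin_conf_space[OF Hausdorff val]
      by (auto simp: multi_continuous_def)
  qed
  then show ?thesis
    by (simp only: continuous_map_unordered_conf_space_iff[OF val])
qed

end
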